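(* Let $((\mathfrak g_0,[\cdot,\cdot]_{\mathfrak g_0},T_0),(\mathfrak g_1,[\cdot,\cdot]_{\mathfrak g_1},T_1),\mathrm d,\rho)$ be a crossed module of Rota-Baxter Lie algebras. Define $\ast_0:\mathfrak g_0\otimes\mathfrak g_0\to\mathfrak g_0$, $\ast_1:\mathfrak g_1\otimes\mathfrak g_1\to\mathfrak g_1$ and $l,r:\mathfrak g_0\to\mathfrak{gl}(\mathfrak g_1)$ by $$x\ast_0y=[T_0x,y]_{\mathfrak g_0},\quad u\ast_1v=[T_1u,v]_{\mathfrak g_1},\quad l_xu=\rho(T_0x)u,\quad r_xu=-\rho(x)T_1(u),\qquad x,y\in\mathfrak g_0,\ u,v\in\mathfrak g_1.$$ Then $((\mathfrak g_0,\ast_0),(\mathfrak g_1,\ast_1),\mathrm d,(l,r))$ is a crossed module of pre-Lie algebras.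
   Context: All vector spaces are finite dimensional over an algebraically closed field $\mathbb K$ of characteristic $0$. A Rota-Baxter Lie algebra $(\mathfrak g,[\cdot,\cdot]_{\mathfrak g},R)$ is a Lie algebra with a linear map $R:\mathfrak g\to\mathfrak g$ satisfying $[R(x),R(y)]_{\mathfrak g}=R([R(x),y]_{\mathfrak g}+[x,R(y)]_{\mathfrak g})$. A homomorphism $(\mathfrak g,R)\to(\mathfrak h,S)$ is a Lie algebra homomorphism $\phi$ with $\phi\circ R=S\circ\phi$. A crossed module of Rota-Baxter Lie algebras consists of Rota-Baxter Lie algebras $(\mathfrak g_0,[\cdot,\cdot]_{\mathfrak g_0},T_0)$ and $(\mathfrak g_1,[\cdot,\cdot]_{\mathfrak g_1},T_1)$, a Rota-Baxter Lie algebra homomorphism $\mathrm d:\mathfrak g_1\to\mathfrak g_0$, and an action $(\rho,T_1)$ of $(\mathfrak g_0,T_0)$ on $\mathfrak g_1$ by derivations, i.e. a Lie algebra homomorphism $\rho:\mathfrak g_0\to\mathrm{Der}(\mathfrak g_1)$ with $\rho(T_0(x))\circ T_1=T_1\circ\rho(T_0(x))+T_1\circ\rho(x)\circ T_1$ for all $x\in\mathfrak g_0$, such that $\mathrm d(\rho(x)(u))=[x,\mathrm du]_{\mathfrak g_0}$ and $\rho(\mathrm du)(v)=[u,v]_{\mathfrak g_1}$ for all $x\in\mathfrak g_0$, $u,v\in\mathfrak g_1$. A pre-Lie algebra $(\mathfrak g,\ast)$ is a vector space with a bilinear multiplication satisfying $(x\ast y)\ast z-x\ast(y\ast z)=(y\ast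 x)\ast z-y\ast(x\ast z)$. Its sub-adjacent Lie algebra $\mathfrak g^c$ is $\mathfrak g$ with bracket $x\ast y-y\ast x$. A representation of $(\mathfrak g,\ast)$ on a vector space $V$ is a pair $(l,r)$, where $l:\mathfrak g\to\mathfrak{gl}(V)$ is a representation of the Lie algebra $\mathfrak g^c$ and $r:\mathfrak g\to\mathfrak{gl}(V)$ is a linear map with $l_xr_y-r_yl_x=r_{x\ast y}-r_yr_x$ for all $x,y\in\mathfrak g$. A crossed module of pre-Lie algebras is a quadruple $((\mathfrak g_0,\ast_0),(\mathfrak g_1,\ast_1),\delta,(l,r))$, where $(\mathfrak g_0,\ast_0)$, $(\mathfrak g_1,\ast_1)$ are pre-Lie algebras, $\delta:\mathfrak g_1\to\mathfrak g_0$ is a pre-Lie algebra homomorphism, and $(l,r)$ is a representation of $(\mathfrak g_0,\ast_0)$ on $\mathfrak g_1$, such that for $x\in\mathfrak g_0$, $u,v\in\mathfrak g_1$: $\delta(l_xu)=x\ast_0\delta u$, $\delta(r_xu)=(\delta u)\ast_0x$, and $l_{\delta u}v=r_{\delta v}u=u\ast_1v$. *)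

theory Defs
  imports "HOL-Computational_Algebra.Polynomial"
begin

text \<open>
  A vector space is a whole type of class \<open>ab_group_add\<close> together with a scalar multiplication,
  as in the library locale \<^locale>\<open>vector_space\<close>.
\<close>

locale fd_vector_space = vector_space scale
  for scale :: "'k::{alg_closed_field, field_char_0} \<Rightarrow> 'a::ab_group_add \<Rightarrow> 'a" +
  assumes finite_dim: "\<exists>B. finite B \<and> span B = UNIV"

definition gl :: "('k::field \<Rightarrow> 'a::ab_group_add \<Rightarrow> 'a) \<Rightarrow> ('a \<Rightarrow> 'a) set" where
  "gl s = {f. Vector_Spaces.linear s s f}"

definition commutator :: "('a::ab_group_add \<Rightarrow> 'a) \<Rightarrow> ('a \<Rightarrow> 'a) \<Rightarrow> 'a \<Rightarrow> 'a" where
  "commutator f g = (\<lambda>v. f (g v) - g (f v))"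

text \<open>The vector space structure on endomorphisms is the pointwise one.\<close>

definition linear_into_gl ::
  "('k::field \<Rightarrow> 'a::ab_group_add \<Rightarrow> 'a) \<Rightarrow> ('k \<Rightarrow> 'v::ab_group_add \<Rightarrow> 'v) \<Rightarrow> ('a \<Rightarrow> 'v \<Rightarrow> 'v) \<Rightarrow> bool" where
  "linear_into_gl s t f \<longleftrightarrow> (\<forall>x. f x \<in> gl t) \<and> (\<forall>v. Vector_Spaces.linear s t (\<lambda>x. f x v))"

locale fd_algebra = fd_vector_space scale
  for scale :: "'k::{alg_closed_field, field_char_0} \<Rightarrow> 'a::ab_group_add \<Rightarrow> 'a" +
  fixes mult :: "'a \<Rightarrow> 'a \<Rightarrow> 'a"
  assumes linear_left: "Vector_Spaces.linear scale scale (\<lambda>x. mult x y)"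
    and linear_right: "Vector_Spaces.linear scale scale (\<lambda>y. mult x y)"

locale fd_algebra_hom =
  dom: fd_algebra s m + cod: fd_algebra t n + Vector_Spaces.linear s t f
  for s :: "'k::{alg_closed_field, field_char_0} \<Rightarrow> 'a::ab_group_add \<Rightarrow> 'a"
    and m :: "'a \<Rightarrow> 'a \<Rightarrow> 'a"
    and t :: "'k \<Rightarrow> 'b::ab_group_add \<Rightarrow> 'b"
    and n :: "'b \<Rightarrow> 'b \<Rightarrow> 'b"
    and f :: "'a \<Rightarrow> 'b" +
  assumes hom_mult: "f (m x y) = n (f x) (f y)"


subsection \<open>Rota-Baxter Lie algebras\<close>

locale lie_algebra = fd_algebra scale bracket
  for scale :: "'k::{alg_closed_field, field_char_0} \<Rightarrow> 'a::ab_group_add \<Rightarrow> 'a"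
    and bracket :: "'a \<Rightarrow> 'a \<Rightarrow> 'a" +
  assumes alternating: "bracket x x = 0"
    and jacobi: "bracket x (bracket y z) + bracket y (bracket z x) + bracket z (bracket x y) = 0"

locale lie_algebra_hom =
  dom: lie_algebra s b + cod: lie_algebra t c + fd_algebra_hom s b t c f
  for s :: "'k::{alg_closed_field, field_char_0} \<Rightarrow> 'a::ab_group_add \<Rightarrow> 'a"
    and b :: "'a \<Rightarrow> 'a \<Rightarrow> 'a"
    and t :: "'k \<Rightarrow> 'b::ab_group_add \<Rightarrow> 'b"
    and c :: "'b \<Rightarrow> 'b \<Rightarrow> 'b"
    and f :: "'a \<Rightarrow> 'b"

locale rota_baxter_lie_algebra = lie_algebra scale bracket
  for scale :: "'k::{alg_closed_field, field_char_0} \<Rightarrow> 'a::ab_group_add \<Rightarrow> 'a"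
    and bracket :: "'a \<Rightarrow> 'a \<Rightarrow> 'a" +
  fixes R :: "'a \<Rightarrow> 'a"
  assumes linear_R: "Vector_Spaces.linear scale scale R"
    and rota_baxter: "bracket (R x) (R y) = R (bracket (R x) y + bracket x (R y))"

locale rota_baxter_lie_algebra_hom =
  dom: rota_baxter_lie_algebra s b R + cod: rota_baxter_lie_algebra t c S +
  lie_algebra_hom s b t c f
  for s :: "'k::{alg_closed_field, field_char_0} \<Rightarrow> 'a::ab_group_add \<Rightarrow> 'a"
    and b :: "'a \<Rightarrow> 'a \<Rightarrow> 'a"
    and R :: "'a \<Rightarrow> 'a"
    and t :: "'k \<Rightarrow> 'b::ab_group_add \<Rightarrow> 'b"
    and c :: "'b \<Rightarrow> 'b \<Rightarrow> 'b"
    and S :: "'b \<Rightarrow> 'b"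
    and f :: "'a \<Rightarrow> 'b" +
  assumes hom_R: "f \<circ> R = S \<circ> f"

definition Der :: "('k::field \<Rightarrow> 'a::ab_group_add \<Rightarrow> 'a) \<Rightarrow> ('a \<Rightarrow> 'a \<Rightarrow> 'a) \<Rightarrow> ('a \<Rightarrow> 'a) set" where
  "Der s b = {D \<in> gl s. \<forall>u v. D (b u v) = b (D u) v + b u (D v)}"

locale lie_representation = lie_algebra s b + V: fd_vector_space t
  for s :: "'k::{alg_closed_field, field_char_0} \<Rightarrow> 'a::ab_group_add \<Rightarrow> 'a"
    and b :: "'a \<Rightarrow> 'a \<Rightarrow> 'a"
    and t :: "'k \<Rightarrow> 'v::ab_group_add \<Rightarrow> 'v" +
  fixes \<rho> :: "'a \<Rightarrow> 'v \<Rightarrow> 'v"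
  assumes linear_rho: "linear_into_gl s t \<rho>"
    and rho_bracket: "\<rho> (b x y) = commutator (\<rho> x) (\<rho> y)"

text \<open>
  The bracket of \<open>Der s\<^sub>1 b\<^sub>1\<close> is the commutator, so a Lie algebra homomorphism into it is a
  representation all of whose values are derivations.
\<close>

locale rota_baxter_action =
  g0: rota_baxter_lie_algebra s\<^sub>0 b\<^sub>0 T\<^sub>0 + g1: rota_baxter_lie_algebra s\<^sub>1 b\<^sub>1 T\<^sub>1 +
  lie_representation s\<^sub>0 b\<^sub>0 s\<^sub>1 \<rho>
  for s\<^sub>0 :: "'k::{alg_closed_field, field_char_0} \<Rightarrow> 'a::ab_group_add \<Rightarrow> 'a"
    and b\<^sub>0 :: "'a \<Rightarrow> 'a \<Rightarrow> 'a"
    and T\<^sub>0 :: "'a \<Rightarrow> 'a"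
    and s\<^sub>1 :: "'k \<Rightarrow> 'b::ab_group_add \<Rightarrow> 'b"
    and b\<^sub>1 :: "'b \<Rightarrow> 'b \<Rightarrow> 'b"
    and T\<^sub>1 :: "'b \<Rightarrow> 'b"
    and \<rho> :: "'a \<Rightarrow> 'b \<Rightarrow> 'b" +
  assumes rho_Der: "\<rho> x \<in> Der s\<^sub>1 b\<^sub>1"
    and rho_rota_baxter: "\<rho> (T\<^sub>0 x) (T\<^sub>1 u) = T\<^sub>1 (\<rho> (T\<^sub>0 x) u) + T\<^sub>1 (\<rho> x (T\<^sub>1 u))"

locale rota_baxter_crossed_module =
  d: rota_baxter_lie_algebra_hom s\<^sub>1 b\<^sub>1 T\<^sub>1 s\<^sub>0 b\<^sub>0 T\<^sub>0 d +
  act: rota_baxter_action s\<^sub>0 b\<^sub>0 T\<^sub>0 s\<^sub>1 b\<^sub>1 T\<^sub>1 \<rho>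
  for s\<^sub>0 :: "'k::{alg_closed_field, field_char_0} \<Rightarrow> 'a::ab_group_add \<Rightarrow> 'a"
    and b\<^sub>0 :: "'a \<Rightarrow> 'a \<Rightarrow> 'a"
    and T\<^sub>0 :: "'a \<Rightarrow> 'a"
    and s\<^sub>1 :: "'k \<Rightarrow> 'b::ab_group_add \<Rightarrow> 'b"
    and b\<^sub>1 :: "'b \<Rightarrow> 'b \<Rightarrow> 'b"
    and T\<^sub>1 :: "'b \<Rightarrow> 'b"
    and d :: "'b \<Rightarrow> 'a"
    and \<rho> :: "'a \<Rightarrow> 'b \<Rightarrow> 'b" +
  assumes equivariance: "d (\<rho> x u) = b\<^sub>0 x (d u)"
    and peiffer: "\<rho> (d u) v = b\<^sub>1 u v"


subsection \<open>Pre-Lie algebras\<close>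

locale pre_lie_algebra = fd_algebra scale mult
  for scale :: "'k::{alg_closed_field, field_char_0} \<Rightarrow> 'a::ab_group_add \<Rightarrow> 'a"
    and mult :: "'a \<Rightarrow> 'a \<Rightarrow> 'a" +
  assumes pre_lie:
    "mult (mult x y) z - mult x (mult y z) = mult (mult y x) z - mult y (mult x z)"

definition sub_adjacent :: "('a::ab_group_add \<Rightarrow> 'a \<Rightarrow> 'a) \<Rightarrow> 'a \<Rightarrow> 'a \<Rightarrow> 'a" where
  "sub_adjacent m = (\<lambda>x y. m x y - m y x)"

locale pre_lie_algebra_hom =
  dom: pre_lie_algebra s m + cod: pre_lie_algebra t n + fd_algebra_hom s m t n f
  for s :: "'k::{alg_closed_field, field_char_0} \<Rightarrow> 'a::ab_group_add \<Rightarrow> 'a"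
    and m :: "'a \<Rightarrow> 'a \<Rightarrow> 'a"
    and t :: "'k \<Rightarrow> 'b::ab_group_add \<Rightarrow> 'b"
    and n :: "'b \<Rightarrow> 'b \<Rightarrow> 'b"
    and f :: "'a \<Rightarrow> 'b"

locale pre_lie_representation =
  g: pre_lie_algebra s m + l: lie_representation s "sub_adjacent m" t l
  for s :: "'k::{alg_closed_field, field_char_0} \<Rightarrow> 'a::ab_group_add \<Rightarrow> 'a"
    and m :: "'a \<Rightarrow> 'a \<Rightarrow> 'a"
    and t :: "'k \<Rightarrow> 'v::ab_group_add \<Rightarrow> 'v"
    and l :: "'a \<Rightarrow> 'v \<Rightarrow> 'v" +
  fixes r :: "'a \<Rightarrow> 'v \<Rightarrow> 'v"
  assumes linear_r: "linear_into_gl s t r"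
    and l_r: "l x (r y v) - r y (l x v) = r (m x y) v - r y (r x v)"

locale pre_lie_crossed_module =
  delta: pre_lie_algebra_hom s\<^sub>1 m\<^sub>1 s\<^sub>0 m\<^sub>0 \<delta> + rep: pre_lie_representation s\<^sub>0 m\<^sub>0 s\<^sub>1 l r
  for s\<^sub>0 :: "'k::{alg_closed_field, field_char_0} \<Rightarrow> 'a::ab_group_add \<Rightarrow> 'a"
    and m\<^sub>0 :: "'a \<Rightarrow> 'a \<Rightarrow> 'a"
    and s\<^sub>1 :: "'k \<Rightarrow> 'b::ab_group_add \<Rightarrow> 'b"
    and m\<^sub>1 :: "'b \<Rightarrow> 'b \<Rightarrow> 'b"
    and \<delta> :: "'b \<Rightarrow> 'a"
    and l :: "'a \<Rightarrow> 'b \<Rightarrow> 'b"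
    and r :: "'a \<Rightarrow> 'b \<Rightarrow> 'b" +
  assumes delta_l: "\<delta> (l x u) = m\<^sub>0 x (\<delta> u)"
    and delta_r: "\<delta> (r x u) = m\<^sub>0 (\<delta> u) x"
    and l_delta: "l (\<delta> u) v = m\<^sub>1 u v"
    and r_delta: "r (\<delta> v) u = m\<^sub>1 u v"

end

theory Submission
  imports Defs
begin

text \<open>
  Both the pre-Lie identity for \<open>[T x, y]\<close> and the compatibility of \<open>(l, r)\<close> come from rewriting
  \<open>[T x, T y]\<close>, respectively \<open>\<rho> (T\<^sub>0 x) (T\<^sub>1 u)\<close>, by the Rota-Baxter identity after expanding a bracket
  by the Jacobi identity, respectively by \<open>\<rho> [x, y] = [\<rho> x, \<rho> y]\<close>.
  The crossed module conditions are equivariance and the Peiffer identity transported along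
  \<open>d \<circ> T\<^sub>1 = T\<^sub>0 \<circ> d\<close>.
\<close>

lemma linear_compose_apply:
  assumes "Vector_Spaces.linear s t f" and "Vector_Spaces.linear t u g"
  shows "Vector_Spaces.linear s u (\<lambda>x. g (f x))"
  using Vector_Spaces.linear_compose[OF assms] by (simp add: comp_def)

lemma linear_uminus:
  assumes "Vector_Spaces.linear s t f"
  shows "Vector_Spaces.linear s t (\<lambda>x. - f x)"
proof -
  interpret Vector_Spaces.linear s t f by fact
  show ?thesis
    by unfold_locales (simp_all add: add scale)
qed

context fd_algebra
begin

sublocale left: Vector_Spaces.linear scale scale "\<lambda>x. mult x y" for y
  by (rule linear_left)

sublocale right: Vector_Spaces.linear scale scale "\<lambda>y. mult x y" for x
  by (rule linear_right)

end

text \<open>Polarisation: expanding \<open>alternating\<close> at \<open>x + y\<close> leaves only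
  the two mixed terms.\<close>

lemma (in lie_algebra) bracket_skew: "bracket y x = - bracket x y"
proof -
  have "bracket (x + y) (x + y) = 0"
    by (rule alternating)
  then have "bracket y x + bracket x y = 0"
    by (simp only: left.add right.add) (simp add: alternating)
  then show ?thesis
    by (simp add: eq_neg_iff_add_eq_0)
qed

text \<open>The Jacobi identity in the form that makes the adjoint map a representation;
  skew-symmetry reorders the cyclic terms.\<close>

lemma (in lie_algebra) bracket_bracket_left:
  "bracket (bracket x y) z = bracket x (bracket y z) - bracket y (bracket x z)"
  using jacobi[of x y z] bracket_skew[of "bracket x y" z] bracket_skew[of z x]
  by (simp add: right.neg algebra_simps)

context pre_lie_algebra
begin

text \<open>The pre-Lie identity, regrouped: left multiplications represent the sub-adjacent
  bracket.\<close>

lemma sub_adjacent_mult: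
  "mult (sub_adjacent mult x y) z = mult x (mult y z) - mult y (mult x z)"
  using pre_lie[of x y z] by (simp add: sub_adjacent_def left.diff algebra_simps)

lemma lie_algebra_sub_adjacent: "lie_algebra scale (sub_adjacent mult)"
proof unfold_locales
  fix x y z
  let ?b = "sub_adjacent mult"
  \<comment> \<open>In this form all products nest to the right, so the twelve terms of the cyclic
    sum cancel in pairs.\<close>
  have b: "?b u (?b v w) = mult u (mult v w) - mult u (mult w v) - mult v (mult w u) + mult w (mult v u)"
    for u v w
  proof -
    \<comment> \<open>Only the outer bracket is unfolded, which keeps the inner one intact as a left
      factor for \<open>sub_adjacent_mult\<close>.\<close>
    have "?b u (?b v w) = mult u (?b v w) - mult (?b v w) u"
      by (rule sub_adjacent_def[THEN fun_cong, THEN fun_cong])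
    then show ?thesis
      by (simp only: sub_adjacent_mult) (simp add: sub_adjacent_def right.diff)
  qed
  show "?b x (?b y z) + ?b y (?b z x) + ?b z (?b x y) = 0"
    by (simp add: b)
qed (simp_all add: sub_adjacent_def left.add left.scale left.diff right.add right.scale
  scale_right_diff_distrib)

end

lemma (in rota_baxter_lie_algebra) pre_lie_algebra_rota_baxter:
  "pre_lie_algebra scale (\<lambda>x y. bracket (R x) y)"
proof -
  interpret R: Vector_Spaces.linear scale scale R
    by (rule linear_R)
  show ?thesis
  proof unfold_locales
    fix x y z
    \<comment> \<open>By linearity and skew-symmetry, both occurrences of \<open>R\<close> merge
      into \<open>R (bracket (R x) y + bracket x (R y))\<close>.\<close>
    have "bracket (R (bracket (R x) y)) z - bracket (R (bracket (R y) x)) z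
        = bracket (bracket (R x) (R y)) z"
      by (simp add: rota_baxter R.add R.neg left.add left.neg bracket_skew[of "R y" x])
    also have "\<dots> = bracket (R x) (bracket (R y) z) - bracket (R y) (bracket (R x) z)"
      by (rule bracket_bracket_left)
    finally show "bracket (R (bracket (R x) y)) z - bracket (R x) (bracket (R y) z)
        = bracket (R (bracket (R y) x)) z - bracket (R y) (bracket (R x) z)"
      by (simp add: algebra_simps)
  qed (simp_all add: R.add R.scale left.add left.scale right.add right.scale)
qed

text \<open>So \<open>R\<close> is a Lie homomorphism from the sub-adjacent algebra to the original
  one, and composing a representation with \<open>R\<close> gives a representation of the
  former.\<close>

lemma (in rota_baxter_lie_algebra) R_sub_adjacent:
  "R (sub_adjacent (\<lambda>x y. bracket (R x) y) x y) = bracket (R x) (R y)"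
  by (simp add: sub_adjacent_def rota_baxter bracket_skew[of "R y" x])

lemma (in rota_baxter_lie_algebra_hom) pre_lie_algebra_hom_rota_baxter:
  "pre_lie_algebra_hom s (\<lambda>x y. b (R x) y) t (\<lambda>x y. c (S x) y) f"
proof -
  interpret P: pre_lie_algebra s "\<lambda>x y. b (R x) y"
    by (rule dom.pre_lie_algebra_rota_baxter)
  interpret Q: pre_lie_algebra t "\<lambda>x y. c (S x) y"
    by (rule cod.pre_lie_algebra_rota_baxter)
  show ?thesis
    by unfold_locales (use hom_R in \<open>simp add: hom_mult fun_eq_iff\<close>)
qed

lemma (in rota_baxter_action) pre_lie_representation_rota_baxter:
  "pre_lie_representation s\<^sub>0 (\<lambda>x y. b\<^sub>0 (T\<^sub>0 x) y) s\<^sub>1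
     (\<lambda>x u. \<rho> (T\<^sub>0 x) u) (\<lambda>x u. - \<rho> x (T\<^sub>1 u))"
proof -
  interpret P: pre_lie_algebra s\<^sub>0 "\<lambda>x y. b\<^sub>0 (T\<^sub>0 x) y"
    by (rule g0.pre_lie_algebra_rota_baxter)
  interpret C: lie_algebra s\<^sub>0 "sub_adjacent (\<lambda>x y. b\<^sub>0 (T\<^sub>0 x) y)"
    by (rule P.lie_algebra_sub_adjacent)
  have rho_fst: "Vector_Spaces.linear s\<^sub>0 s\<^sub>1 (\<lambda>x. \<rho> x v)" for v
    using linear_rho by (simp add: linear_into_gl_def)
  have rho_snd: "Vector_Spaces.linear s\<^sub>1 s\<^sub>1 (\<rho> x)" for x
    using linear_rho by (simp add: linear_into_gl_def gl_def)
  interpret rho: Vector_Spaces.linear s\<^sub>1 s\<^sub>1 "\<rho> x" for x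
    by (rule rho_snd)
  show ?thesis
  proof unfold_locales
    show "linear_into_gl s\<^sub>0 s\<^sub>1 (\<lambda>x u. \<rho> (T\<^sub>0 x) u)"
      using rho_snd linear_compose_apply[OF g0.linear_R rho_fst]
      by (simp add: linear_into_gl_def gl_def)
    show "linear_into_gl s\<^sub>0 s\<^sub>1 (\<lambda>x u. - \<rho> x (T\<^sub>1 u))"
      using linear_uminus[OF rho_fst]
        linear_uminus[OF linear_compose_apply[OF g1.linear_R rho_snd]]
      by (simp add: linear_into_gl_def gl_def)
    show "\<rho> (T\<^sub>0 (sub_adjacent (\<lambda>x y. b\<^sub>0 (T\<^sub>0 x) y) x y))
        = commutator (\<rho> (T\<^sub>0 x)) (\<rho> (T\<^sub>0 y))" for x y
      by (simp add: g0.R_sub_adjacent rho_bracket)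
    \<comment> \<open>Expanding \<open>\<rho> (b\<^sub>0 (T\<^sub>0 x) y)\<close> and cancelling the
      common term leaves \<open>\<rho> y\<close> applied to \<open>rho_rota_baxter\<close>.\<close>
    show "\<rho> (T\<^sub>0 x) (- \<rho> y (T\<^sub>1 v)) - - \<rho> y (T\<^sub>1 (\<rho> (T\<^sub>0 x) v))
        = - \<rho> (b\<^sub>0 (T\<^sub>0 x) y) (T\<^sub>1 v) - - \<rho> y (T\<^sub>1 (- \<rho> x (T\<^sub>1 v)))" for x y v
    proof -
      interpret T1: Vector_Spaces.linear s\<^sub>1 s\<^sub>1 T\<^sub>1
        by (rule g1.linear_R)
      show ?thesis
        by (simp add: rho_bracket commutator_def rho_rota_baxter rho.add rho.neg T1.neg)
    qed
  qed
qed

theorem proposition4p8: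
  fixes s\<^sub>0 :: "'k::{alg_closed_field, field_char_0} \<Rightarrow> 'a::ab_group_add \<Rightarrow> 'a"
    and b\<^sub>0 :: "'a \<Rightarrow> 'a \<Rightarrow> 'a"
    and T\<^sub>0 :: "'a \<Rightarrow> 'a"
    and s\<^sub>1 :: "'k \<Rightarrow> 'b::ab_group_add \<Rightarrow> 'b"
    and b\<^sub>1 :: "'b \<Rightarrow> 'b \<Rightarrow> 'b"
    and T\<^sub>1 :: "'b \<Rightarrow> 'b"
    and d :: "'b \<Rightarrow> 'a"
    and \<rho> :: "'a \<Rightarrow> 'b \<Rightarrow> 'b"
  assumes "rota_baxter_crossed_module s\<^sub>0 b\<^sub>0 T\<^sub>0 s\<^sub>1 b\<^sub>1 T\<^sub>1 d \<rho>"
  shows "pre_lie_crossed_module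
           s\<^sub>0 (\<lambda>x y. b\<^sub>0 (T\<^sub>0 x) y)
           s\<^sub>1 (\<lambda>u v. b\<^sub>1 (T\<^sub>1 u) v)
           d
           (\<lambda>x u. \<rho> (T\<^sub>0 x) u)
           (\<lambda>x u. - \<rho> x (T\<^sub>1 u))"
proof -
  interpret rota_baxter_crossed_module s\<^sub>0 b\<^sub>0 T\<^sub>0 s\<^sub>1 b\<^sub>1 T\<^sub>1 d \<rho>
    by (rule assms)
  interpret H: pre_lie_algebra_hom s\<^sub>1 "\<lambda>u v. b\<^sub>1 (T\<^sub>1 u) v" s\<^sub>0 "\<lambda>x y. b\<^sub>0 (T\<^sub>0 x) y" d
    by (rule d.pre_lie_algebra_hom_rota_baxter)
  interpret P: pre_lie_representation s\<^sub>0 "\<lambda>x y. b\<^sub>0 (T\<^sub>0 x) y" s\<^sub>1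
      "\<lambda>x u. \<rho> (T\<^sub>0 x) u" "\<lambda>x u. - \<rho> x (T\<^sub>1 u)"
    by (rule act.pre_lie_representation_rota_baxter)
  \<comment> \<open>Oriented to expose \<open>d (T\<^sub>1 u)\<close>, to which
    \<open>equivariance\<close> and \<open>peiffer\<close> apply.\<close>
  have dT: "T\<^sub>0 (d u) = d (T\<^sub>1 u)" for u
    using d.hom_R by (simp add: fun_eq_iff)
  show ?thesis
  proof unfold_locales
    \<comment> \<open>In both conditions on the right action, its minus sign absorbs the swap of the
      bracket arguments.\<close>
    show "d (- \<rho> x (T\<^sub>1 u)) = b\<^sub>0 (T\<^sub>0 (d u)) x" for x u
      by (simp add: d.neg equivariance dT d.cod.bracket_skew[of "d (T\<^sub>1 u)" x])
    show "- \<rho> (d v) (T\<^sub>1 u) = b\<^sub>1 (T\<^sub>1 u) v" for u v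
      by (simp add: peiffer d.dom.bracket_skew[of "T\<^sub>1 u" v])
  qed (simp_all add: equivariance peiffer dT)
qed

end
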